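(* Let $\mathcal{X}$ be a finite state space, $\pi$ a probability mass function on $\mathcal{X}$ with full support, $P \in \mathcal{S}(\pi)$ and $Q \in \mathcal{I}(\pi) \cap \mathcal{L}$. Let $\Pi$ be the matrix each of whose rows equals $\pi$, and let $\overline{P}=\overline{P}(Q):=\frac12(P+QP^*Q)$. Then $$ D^{\pi}_{KL}(\overline{P} \| \Pi) \leq D^{\pi}_{KL}(P \| \overline{P}) + D^{\pi}_{KL}(\overline{P} \| \Pi) = D^{\pi}_{KL}(P \| \Pi), $$ and equality holds in the inequality if and only if $P \in \mathcal{L}(\pi,Q)$ (so that $\overline{P}(Q) = P$). Moreover, if $P$ is further assumed to be $\pi$-reversible, then $$ c_{KL}(\overline{P}(Q)) \leq c_{KL}(P). $$
   Context: $\mathcal{L}$ is the set of transition (row-stochastic) matrices on $\mathcal{X}$; $\mathcal{S}(\pi)\subseteq\mathcal{L}$ is the set of those $P$ with $\pi P=\pi$. For a matrix $M$, $M^*(x,y)=\frac{\pi(y)}{\pi(x)}M(y,x)$; $P$ is $\pi$-reversible iff $P=P^*$. $\mathcal{I}(\pi)$ is the set of real matrices $Q$ with $Q^2=I$ and $Q^*=Q$. $\mathcal{L}(\pi,Q)$ is the set of $L\in\mathcal{S}(\pi)$ with $L^*=QLQ$. For $M,N\in\mathcal{L}$, $D^\pi_{KL}(M\|N):=\sum_x\pi(x)\sum_y M(x,y)\ln\frac{M(x,y)}{N(x,y)}\in[0,\infty]$, with $0\ln(0/0)=0$, $0\cdot\infty=0$ and $a\ln(a/0)=+\infty$ for $a>0$.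 The KL-divergence Dobrushin coefficient of $P\in\mathcal{S}(\pi)$ is $c_{KL}(P):=\sup \frac{D^\pi_{KL}(MP\|NP)}{D^\pi_{KL}(M\|N)}\in[0,1]$, the supremum being over $M,N\in\mathcal{S}(\pi)$ with $M\ne N$ and $D^\pi_{KL}(M\|N)<\infty$ (taken to be $0$ if there are no such pairs). *)

theory Defs
  imports "HOL-Probability.Probability"
begin

text \<open>
  The finite state space is a type of class \<^class>\<open>finite\<close>; matrices are indexed as
  \<open>M $ x $ y\<close> with \<open>x\<close> the row.
\<close>

definition pmf_vec :: "'n::finite pmf \<Rightarrow> real ^ 'n" where
  "pmf_vec \<pi> = (\<chi> x. pmf \<pi> x)"

definition transition_matrices :: "(real ^ 'n::finite ^ 'n) set" where
  "transition_matrices = {M. (\<forall>x y. 0 \<le> M $ x $ y) \<and> (\<forall>x. (\<Sum>y\<in>UNIV. M $ x $ y) = 1)}"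

definition stationary_matrices :: "'n::finite pmf \<Rightarrow> (real ^ 'n ^ 'n) set" where
  "stationary_matrices \<pi> = {P \<in> transition_matrices. pmf_vec \<pi> v* P = pmf_vec \<pi>}"

definition adj :: "'n::finite pmf \<Rightarrow> real ^ 'n ^ 'n \<Rightarrow> real ^ 'n ^ 'n" where
  "adj \<pi> M = (\<chi> x y. pmf \<pi> y / pmf \<pi> x * M $ y $ x)"

definition reversible :: "'n::finite pmf \<Rightarrow> real ^ 'n ^ 'n \<Rightarrow> bool" where
  "reversible \<pi> P \<longleftrightarrow> P = adj \<pi> P"

definition involutions :: "'n::finite pmf \<Rightarrow> (real ^ 'n ^ 'n) set" where
  "involutions \<pi> = {Q. Q ** Q = mat 1 \<and> adj \<pi> Q = Q}"

definition Q_reversible_matrices ::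
    "'n::finite pmf \<Rightarrow> real ^ 'n ^ 'n \<Rightarrow> (real ^ 'n ^ 'n) set" where
  "Q_reversible_matrices \<pi> Q = {L \<in> stationary_matrices \<pi>. adj \<pi> L = Q ** L ** Q}"

definition stationary_projection :: "'n::finite pmf \<Rightarrow> real ^ 'n ^ 'n" where
  "stationary_projection \<pi> = (\<chi> x. pmf_vec \<pi>)"

definition symmetrization ::
    "'n::finite pmf \<Rightarrow> real ^ 'n ^ 'n \<Rightarrow> real ^ 'n ^ 'n \<Rightarrow> real ^ 'n ^ 'n" where
  "symmetrization \<pi> Q P = (1 / 2) *\<^sub>R (P + Q ** adj \<pi> P ** Q)"

text \<open>
  \<open>kl_term a b\<close> is \<open>a ln (a / b)\<close> for \<open>a, b \<ge> 0\<close>, with \<open>0 ln (0 / b) = 0\<close> for every \<open>b\<close>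
  (including \<open>b = 0\<close>) and \<open>a ln (a / 0) = \<infinity>\<close> for \<open>a > 0\<close>. The case distinction is needed because
  real division by zero yields zero. Single terms may be negative, but none is \<open>-\<infinity>\<close>, so the sums
  in \<^typ>\<open>ereal\<close> below are unproblematic; there \<open>0 * \<infinity> = 0\<close>.
\<close>

definition kl_term :: "real \<Rightarrow> real \<Rightarrow> ereal" where
  "kl_term a b = (if a = 0 then 0 else if b = 0 then \<infinity> else ereal (a * ln (a / b)))"

definition D_KL :: "'n::finite pmf \<Rightarrow> real ^ 'n ^ 'n \<Rightarrow> real ^ 'n ^ 'n \<Rightarrow> ereal" where
  "D_KL \<pi> M N = (\<Sum>x\<in>UNIV. ereal (pmf \<pi> x) * (\<Sum>y\<in>UNIV. kl_term (M $ x $ y) (N $ x $ y)))"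

definition c_KL_ratios :: "'n::finite pmf \<Rightarrow> real ^ 'n ^ 'n \<Rightarrow> ereal set" where
  "c_KL_ratios \<pi> P = {D_KL \<pi> (M ** P) (N ** P) / D_KL \<pi> M N | M N.
     M \<in> stationary_matrices \<pi> \<and> N \<in> stationary_matrices \<pi> \<and> M \<noteq> N \<and> D_KL \<pi> M N < \<infinity>}"

text \<open>The supremum of the empty set in \<^typ>\<open>ereal\<close> is \<open>-\<infinity>\<close>, hence the separate case.\<close>

definition c_KL :: "'n::finite pmf \<Rightarrow> real ^ 'n ^ 'n \<Rightarrow> ereal" where
  "c_KL \<pi> P = (if c_KL_ratios \<pi> P = {} then 0 else Sup (c_KL_ratios \<pi> P))"

end

theory Submission
  imports Defs
begin

text \<open>
  A stochastic involution \<open>Q\<close> is the permutation matrix of an involution \<open>\<sigma>\<close>, and self-adjointness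
  makes \<open>\<sigma>\<close> preserve \<open>\<pi>\<close>. Hence \<open>Q P\<^sup>* Q\<close> has the edge measure of \<open>P\<close> transported by the
  involution \<open>(x, y) \<mapsto> (\<sigma> y, \<sigma> x)\<close> of pairs. The log-density of the symmetrization with respect
  to \<open>\<pi> \<otimes> \<pi>\<close> is invariant under this map, so it has the same integral against both edge measures,
  which is the Pythagorean identity; Gibbs' inequality gives the case of equality. For reversible
  \<open>P\<close>, convexity bounds the divergence after \<open>(P + Q P Q) / 2\<close> by the mean of those after \<open>P\<close> and
  \<open>Q P Q\<close>, and \<open>M \<mapsto> M Q\<close> is a divergence-preserving map of the stationary matrices.
\<close>

subsection \<open>Gibbs and log-sum inequalities\<close>

text \<open>This is \<open>ln t \<le> t - 1\<close> at \<open>t = b / a\<close>. Summed over a row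
  of two stochastic matrices, the linear left-hand sides cancel, which is Gibbs' inequality.\<close>

lemma mult_ln_div_ge:
  fixes a b :: real
  assumes "0 \<le> a" "0 \<le> b" "b = 0 \<Longrightarrow> a = 0"
  shows "a - b \<le> a * ln (a / b)"
proof (cases "a = 0")
  case False
  with assms have pos: "a > 0" "b > 0" by (auto simp: less_le)
  have "ln (b / a) \<le> b / a - 1" using pos by (intro ln_le_minus_one) simp
  then have "a * ln (b / a) \<le> a * (b / a - 1)" using pos by (intro mult_left_mono) auto
  also have "\<dots> = b - a" using pos by (simp add: field_simps)
  finally show ?thesis using pos by (simp add: ln_div algebra_simps)
qed (use assms in auto)

text \<open>The bound \<open>ln t \<le> t - 1\<close> is attained only at
  \<open>t = 1\<close>.\<close>

lemma mult_ln_div_eq_diffD: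
  fixes a b :: real
  assumes "0 \<le> a" "0 \<le> b" "b = 0 \<Longrightarrow> a = 0" "a * ln (a / b) = a - b"
  shows "a = b"
proof (cases "a = 0")
  case False
  with assms have pos: "a > 0" "b > 0" by (auto simp: less_le)
  have "a * ln (b / a) = b - a" using assms(4) pos by (simp add: ln_div algebra_simps)
  then have "ln (b / a) = b / a - 1" using pos by (simp add: field_simps)
  then have "b / a = 1" using pos by (intro ln_eq_minus_one) simp_all
  then show ?thesis using pos by simp
qed (use assms in auto)

text \<open>With \<open>r\<close> the ratio of the two sums, each summand on the right is bounded
  below by its tangent at slope \<open>r\<close>; the linear parts of the two tangents
  cancel.\<close>

lemma log_sum_inequality:
  fixes a b a' b' :: real
  assumes "0 \<le> a" "0 \<le> b" "b = 0 \<Longrightarrow> a = 0"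
    and "0 \<le> a'" "0 \<le> b'" "b' = 0 \<Longrightarrow> a' = 0"
  shows "(a + a') * ln ((a + a') / (b + b')) \<le> a * ln (a / b) + a' * ln (a' / b')"
proof (cases "a + a' = 0")
  case True
  then have "a = 0" "a' = 0" using assms by auto
  then show ?thesis by simp
next
  case False
  define r where "r = (a + a') / (b + b')"
  have s: "a + a' > 0" using False assms by linarith
  then have t: "b + b' > 0" using assms by (cases "b = 0"; cases "b' = 0") auto
  have r: "r > 0" using s t by (simp add: r_def)
  \<comment> \<open>The previous Gibbs bound with \<open>d\<close> rescaled to
    \<open>d * r\<close>.\<close>
  have tangent: "c - d * r + c * ln r \<le> c * ln (c / d)"
    if "0 \<le> c" "0 \<le> d" "d = 0 \<Longrightarrow> c = 0" for c d
  proof (cases "c = 0")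
    case False
    with that have "c > 0" "d > 0" by (auto simp: less_le)
    then show ?thesis
      using mult_ln_div_ge[of c "d * r"] r by (simp add: ln_div ln_mult algebra_simps)
  qed (use that r in auto)
  have "(b + b') * r = a + a'" using t by (simp add: r_def)
  then show ?thesis
    using tangent[OF assms(1,2,3)] tangent[OF assms(4,5,6)]
    by (simp add: algebra_simps flip: r_def)
qed

subsection \<open>The divergence\<close>

definition abs_cont :: "real ^ 'n::finite ^ 'n \<Rightarrow> real ^ 'n ^ 'n \<Rightarrow> bool" where
  "abs_cont M N \<longleftrightarrow> (\<forall>x y. N $ x $ y = 0 \<longrightarrow> M $ x $ y = 0)"

text \<open>Wherever \<open>N\<close> vanishes so does \<open>M\<close>, so the factor in front of
  the logarithm hides the value of the division by zero and the divergence is a real sum.\<close>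

lemma D_KL_abs_cont:
  assumes "abs_cont M N"
  shows "D_KL \<pi> M N =
    ereal (\<Sum>x\<in>UNIV. pmf \<pi> x * (\<Sum>y\<in>UNIV. M $ x $ y * ln (M $ x $ y / N $ x $ y)))"
proof -
  have "kl_term (M $ x $ y) (N $ x $ y) = ereal (M $ x $ y * ln (M $ x $ y / N $ x $ y))" for x y
    using assms by (auto simp: kl_term_def abs_cont_def)
  then show ?thesis by (simp add: D_KL_def)
qed

text \<open>One infinite term makes its row sum infinite, as no term is \<open>-\<infinity>\<close>,
  and full support keeps the weight \<open>0\<close> from absorbing it.\<close>

lemma D_KL_finiteD:
  assumes full: "set_pmf \<pi> = UNIV" and fin: "D_KL \<pi> M N < \<infinity>"
  shows "abs_cont M N"
proof (rule ccontr)
  assume "\<not> abs_cont M N"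
  then obtain x y where xy: "N $ x $ y = 0" "M $ x $ y \<noteq> 0" by (auto simp: abs_cont_def)
  have "pmf \<pi> x > 0" using full by (simp add: pmf_positive)
  moreover have "(\<Sum>y\<in>UNIV. kl_term (M $ x $ y) (N $ x $ y)) = \<infinity>"
    using xy by (auto simp: sum_Pinfty kl_term_def)
  ultimately have "D_KL \<pi> M N = \<infinity>"
    unfolding D_KL_def by (auto simp: sum_Pinfty)
  with fin show False by simp
qed

lemma D_KL_nonneg:
  assumes M: "M \<in> transition_matrices" and N: "N \<in> transition_matrices" and ac: "abs_cont M N"
  shows "0 \<le> D_KL \<pi> M N"
proof -
  have "0 \<le> (\<Sum>y\<in>UNIV. M $ x $ y * ln (M $ x $ y / N $ x $ y))" for x
  proof -
    have "(\<Sum>y\<in>UNIV. M $ x $ y - N $ x $ y) \<le> (\<Sum>y\<in>UNIV. M $ x $ y * ln (M $ x $ y / N $ x $ y))"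
      using M N ac by (intro sum_mono mult_ln_div_ge) (auto simp: transition_matrices_def abs_cont_def)
    then show ?thesis using M N by (simp add: transition_matrices_def sum_subtractf)
  qed
  then show ?thesis by (simp add: D_KL_abs_cont[OF ac] sum_nonneg)
qed

lemma D_KL_eq_0D:
  assumes full: "set_pmf \<pi> = UNIV"
    and M: "M \<in> transition_matrices" and N: "N \<in> transition_matrices"
    and zero: "D_KL \<pi> M N = 0"
  shows "M = N"
proof -
  have ac: "abs_cont M N" using D_KL_finiteD[OF full] zero by simp
  \<comment> \<open>The slack in the Gibbs bound: it is nonnegative entrywise, and its row sums are
    those of the divergence because the rows of \<open>M\<close> and \<open>N\<close> have equal
    mass.\<close>
  define g where "g x y = M $ x $ y * ln (M $ x $ y / N $ x $ y) - (M $ x $ y - N $ x $ y)" for x y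
  have g: "0 \<le> g x y" for x y
    using M N ac mult_ln_div_ge[of "M $ x $ y" "N $ x $ y"]
    by (auto simp: transition_matrices_def abs_cont_def g_def)
  have "(\<Sum>y\<in>UNIV. g x y) = (\<Sum>y\<in>UNIV. M $ x $ y * ln (M $ x $ y / N $ x $ y))" for x
    using M N by (simp add: transition_matrices_def sum_subtractf g_def)
  then have "(\<Sum>x\<in>UNIV. pmf \<pi> x * (\<Sum>y\<in>UNIV. g x y)) = 0"
    using zero by (simp add: D_KL_abs_cont[OF ac] zero_ereal_def)
  then have "pmf \<pi> x * (\<Sum>y\<in>UNIV. g x y) = 0" for x
    by (subst (asm) sum_nonneg_eq_0_iff) (auto intro!: mult_nonneg_nonneg sum_nonneg g)
  moreover have "pmf \<pi> x \<noteq> 0" for x using full set_pmf_iff by fastforce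
  ultimately have "(\<Sum>y\<in>UNIV. g x y) = 0" for x by simp
  then have "g x y = 0" for x y
    using g by (intro sum_nonneg_0[of UNIV "g x"]) auto
  then have "M $ x $ y = N $ x $ y" for x y
    using M N ac mult_ln_div_eq_diffD[of "M $ x $ y" "N $ x $ y"]
    by (auto simp: transition_matrices_def abs_cont_def g_def)
  then show ?thesis by (simp add: vec_eq_iff)
qed

text \<open>Joint convexity, weakened from the mean to the maximum. That suffices for comparison
  with a supremum and is trivial when one side is infinite.\<close>

lemma D_KL_midpoint_le_max:
  fixes A B A' B' :: "real ^ 'n::finite ^ 'n"
  assumes full: "set_pmf \<pi> = UNIV"
    and nonneg: "\<And>x y. 0 \<le> A $ x $ y" "\<And>x y. 0 \<le> B $ x $ y"
      "\<And>x y. 0 \<le> A' $ x $ y" "\<And>x y. 0 \<le> B' $ x $ y"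
  shows "D_KL \<pi> ((1 / 2) *\<^sub>R (A + A')) ((1 / 2) *\<^sub>R (B + B')) \<le> max (D_KL \<pi> A B) (D_KL \<pi> A' B')"
proof (cases "D_KL \<pi> A B < \<infinity> \<and> D_KL \<pi> A' B' < \<infinity>")
  case True
  then have ac: "abs_cont A B" "abs_cont A' B'" using D_KL_finiteD[OF full] by auto
  then have ac2: "abs_cont ((1 / 2) *\<^sub>R (A + A')) ((1 / 2) *\<^sub>R (B + B'))"
    using nonneg by (auto simp: abs_cont_def add_nonneg_eq_0_iff)
  define S where "S = (\<lambda>M N :: real ^ 'n ^ 'n. \<Sum>x\<in>UNIV. pmf \<pi> x *
    (\<Sum>y\<in>UNIV. M $ x $ y * ln (M $ x $ y / N $ x $ y)))"
  have D: "D_KL \<pi> M N = ereal (S M N)" if "abs_cont M N" for M N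
    using D_KL_abs_cont[OF that] by (simp add: S_def)
  have "S ((1 / 2) *\<^sub>R (A + A')) ((1 / 2) *\<^sub>R (B + B'))
      \<le> (\<Sum>x\<in>UNIV. pmf \<pi> x * (\<Sum>y\<in>UNIV. (1 / 2) *
          (A $ x $ y * ln (A $ x $ y / B $ x $ y) + A' $ x $ y * ln (A' $ x $ y / B' $ x $ y))))"
    unfolding S_def
  proof (intro sum_mono mult_left_mono)
    fix x y
    show "((1 / 2) *\<^sub>R (A + A')) $ x $ y *
        ln (((1 / 2) *\<^sub>R (A + A')) $ x $ y / ((1 / 2) *\<^sub>R (B + B')) $ x $ y)
      \<le> (1 / 2) * (A $ x $ y * ln (A $ x $ y / B $ x $ y) + A' $ x $ y * ln (A' $ x $ y / B' $ x $ y))"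
    proof -
      have "(A $ x $ y + A' $ x $ y) * ln ((A $ x $ y + A' $ x $ y) / (B $ x $ y + B' $ x $ y))
        \<le> A $ x $ y * ln (A $ x $ y / B $ x $ y) + A' $ x $ y * ln (A' $ x $ y / B' $ x $ y)"
        using nonneg ac by (intro log_sum_inequality) (auto simp: abs_cont_def)
      \<comment> \<open>The weights cancel inside the logarithm, which leaves the log-sum inequality
        scaled by one half.\<close>
      moreover have "(1 / 2 * u) / (1 / 2 * v) = u / v" for u v :: real by simp
      ultimately show ?thesis
        by (simp only: vector_scaleR_component vector_add_component real_scaleR_def mult.assoc)
          (intro mult_left_mono, simp_all)
    qed
  qed simp
  also have "\<dots> = (S A B + S A' B') / 2"
    by (simp add: S_def sum.distrib ring_distribs add_divide_distrib flip: sum_divide_distrib)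
  also have "\<dots> \<le> max (S A B) (S A' B')" by (simp add: max_def)
  finally show ?thesis by (auto simp: D ac ac2 le_max_iff_disj)
qed auto

subsection \<open>Stochastic involutions\<close>

lemma transition_matrices_mult:
  assumes "M \<in> transition_matrices" "N \<in> transition_matrices"
  shows "M ** N \<in> transition_matrices"
proof -
  have "(\<Sum>y\<in>UNIV. \<Sum>k\<in>UNIV. M $ x $ k * N $ k $ y) = 1" for x
    using assms by (subst sum.swap) (simp add: transition_matrices_def flip: sum_distrib_left)
  with assms show ?thesis
    by (auto simp: transition_matrices_def matrix_matrix_mult_def intro!: sum_nonneg)
qed

lemma stationary_matrices_mult:
  assumes "M \<in> stationary_matrices \<pi>" "N \<in> stationary_matrices \<pi>"
  shows "M ** N \<in> stationary_matrices \<pi>"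
  using assms transition_matrices_mult
  by (auto simp: stationary_matrices_def simp flip: vector_matrix_mul_assoc)

text \<open>Stationarity of \<open>P\<close> says exactly that the rows of its time reversal sum to
  one.\<close>

lemma adj_mem_transition_matrices:
  assumes full: "set_pmf \<pi> = UNIV" and P: "P \<in> stationary_matrices \<pi>"
  shows "adj \<pi> P \<in> transition_matrices"
proof -
  have pos: "pmf \<pi> x > 0" for x using full by (simp add: pmf_positive)
  have "(\<Sum>y\<in>UNIV. pmf \<pi> y * P $ y $ x) = pmf \<pi> x" for x
    using P by (auto simp: stationary_matrices_def vector_matrix_mult_def pmf_vec_def vec_eq_iff mult.commute)
  then have "(\<Sum>y\<in>UNIV. pmf \<pi> y / pmf \<pi> x * P $ y $ x) = 1" for x
    using pos[of x] by (simp flip: sum_divide_distrib)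
  with P show ?thesis
    by (auto simp: adj_def transition_matrices_def stationary_matrices_def)
qed

text \<open>Self-adjointness is detailed balance; summing it over one variable gives
  stationarity.\<close>

lemma self_adjoint_stationary:
  assumes full: "set_pmf \<pi> = UNIV" and Q: "Q \<in> transition_matrices" and adj: "adj \<pi> Q = Q"
  shows "Q \<in> stationary_matrices \<pi>"
proof -
  have pos: "pmf \<pi> x > 0" for x using full by (simp add: pmf_positive)
  have "Q $ x $ y = pmf \<pi> y / pmf \<pi> x * Q $ y $ x" for x y
    using adj by (simp add: adj_def vec_eq_iff)
  then have "Q $ x $ y * pmf \<pi> x = pmf \<pi> y * Q $ y $ x" for x y
    using pos[of x] by (metis (no_types, lifting) less_irrefl nonzero_eq_divide_eq times_divide_eq_left)
  then have "(\<Sum>y\<in>UNIV. pmf \<pi> y * Q $ y $ x) = (\<Sum>y\<in>UNIV. Q $ x $ y) * pmf \<pi> x" for x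
    by (simp add: sum_distrib_right)
  then have "pmf_vec \<pi> v* Q = pmf_vec \<pi>"
    using Q by (simp add: vector_matrix_mult_def pmf_vec_def vec_eq_iff transition_matrices_def mult.commute)
  with Q show ?thesis by (simp add: stationary_matrices_def)
qed

lemma stochastic_involution_permutation:
  assumes Q: "Q \<in> transition_matrices" and inv: "Q ** Q = mat 1"
  obtains \<sigma> where "\<And>x. \<sigma> (\<sigma> x) = x" "\<And>x y. Q $ x $ y = (if y = \<sigma> x then 1 else 0)"
proof -
  have nonneg: "0 \<le> Q $ x $ y" and row: "(\<Sum>y\<in>UNIV. Q $ x $ y) = 1" for x y
    using Q by (auto simp: transition_matrices_def)
  \<comment> \<open>The two-step path from \<open>x\<close> through \<open>y\<close> to
    \<open>z\<close> has weight zero for \<open>z \<noteq> x\<close>, so a positive entry at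
    \<open>(x, y)\<close> forces row \<open>y\<close> to be the unit vector at
    \<open>x\<close>.\<close>
  have return_row: "Q $ y $ z = (if z = x then 1 else 0)" if "Q $ x $ y > 0" for x y z
  proof -
    have 0: "Q $ y $ z = 0" if "z \<noteq> x" for z
    proof -
      have "(\<Sum>k\<in>UNIV. Q $ x $ k * Q $ k $ z) = 0"
        using inv that by (auto simp: matrix_matrix_mult_def mat_def vec_eq_iff)
      then have "Q $ x $ y * Q $ y $ z = 0"
        using nonneg by (subst (asm) sum_nonneg_eq_0_iff) auto
      with \<open>Q $ x $ y > 0\<close> show ?thesis by simp
    qed
    have "(\<Sum>z\<in>UNIV. Q $ y $ z) = Q $ y $ x"
      using 0 by (subst sum.remove[of _ x]) auto
    with 0 row show ?thesis by auto
  qed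
  have "\<exists>y. Q $ x $ y > 0" for x
    using row[of x] nonneg[of x] by (metis less_le sum.neutral zero_neq_one)
  then obtain \<sigma> where \<sigma>: "\<And>x. Q $ x $ \<sigma> x > 0" by metis
  \<comment> \<open>Applied twice: row \<open>\<sigma> x\<close> is the unit vector at
    \<open>x\<close>, so its entry at \<open>x\<close> is positive, and this in turn determines row
    \<open>x\<close>.\<close>
  have eq: "Q $ x $ y = (if y = \<sigma> x then 1 else 0)" for x y
    using return_row[of "\<sigma> x" x y] return_row[OF \<sigma>, of x x] by simp
  have "\<sigma> (\<sigma> x) = x" for x
    using return_row[OF \<sigma>[of x], of x] eq[of "\<sigma> x" x] by (simp split: if_splits)
  with eq that show thesis by blast
qed

section \<open>Symmetrization by a measure-preserving involution\<close>

locale stationary_involution =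
  fixes \<pi> :: "'n::finite pmf" and Q :: "real ^ 'n ^ 'n" and \<sigma> :: "'n \<Rightarrow> 'n"
  assumes full: "set_pmf \<pi> = UNIV"
    and Q_involutions: "Q \<in> involutions \<pi>" and Q_transition: "Q \<in> transition_matrices"
    and \<sigma>_\<sigma>: "\<sigma> (\<sigma> x) = x" and Q_nth: "Q $ x $ y = (if y = \<sigma> x then 1 else 0)"
begin

lemma pmf_pos: "pmf \<pi> x > 0"
  using full by (simp add: pmf_positive)

lemma QQ: "Q ** Q = mat 1" and Q_stationary: "Q \<in> stationary_matrices \<pi>"
  using self_adjoint_stationary[OF full Q_transition] Q_involutions by (auto simp: involutions_def)

text \<open>Self-adjointness at the entry \<open>(x, \<sigma> x)\<close>, where \<open>Q\<close> and
  its transpose are both \<open>1\<close>, leaves only the ratio of the two masses.\<close>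

lemma pmf_\<sigma>: "pmf \<pi> (\<sigma> x) = pmf \<pi> x"
proof -
  have "adj \<pi> Q $ x $ \<sigma> x = Q $ x $ \<sigma> x" using Q_involutions by (simp add: involutions_def)
  then show ?thesis using pmf_pos[of x] by (simp add: adj_def Q_nth \<sigma>_\<sigma>)
qed

lemma bij_\<sigma>: "bij \<sigma>"
  using \<sigma>_\<sigma> by (rule involuntory_imp_bij)

lemma mult_Q_nth: "(A ** Q) $ x $ y = A $ x $ \<sigma> y"
proof -
  have "(y = \<sigma> z) = (z = \<sigma> y)" for z using \<sigma>_\<sigma> by metis
  then show ?thesis by (simp add: matrix_matrix_mult_def Q_nth if_distrib cong: if_cong)
qed

lemma Q_mult_nth: "(Q ** A) $ x $ y = A $ \<sigma> x $ y"
  by (simp add: matrix_matrix_mult_def Q_nth if_distrib[of "\<lambda>t. t * _"] cong: if_cong)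

lemma symmetrization_nth:
  "symmetrization \<pi> Q P $ x $ y = (P $ x $ y + pmf \<pi> y / pmf \<pi> x * P $ \<sigma> y $ \<sigma> x) / 2"
  by (simp add: symmetrization_def mult_Q_nth Q_mult_nth adj_def pmf_\<sigma>)

text \<open>Right multiplication by \<open>Q\<close> permutes the columns of both arguments
  alike.\<close>

lemma D_KL_mult_Q: "D_KL \<pi> (M ** Q) (N ** Q) = D_KL \<pi> M N"
proof -
  have "(\<Sum>y\<in>UNIV. kl_term (M $ x $ \<sigma> y) (N $ x $ \<sigma> y))
      = (\<Sum>y\<in>UNIV. kl_term (M $ x $ y) (N $ x $ y))" for x
    by (rule sum.reindex_bij_betw[OF bij_\<sigma>])
  then show ?thesis by (simp add: D_KL_def mult_Q_nth)
qed

text \<open>The edge measure of the symmetrization is the mean of that of \<open>P\<close> and its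
  image under \<open>(x, y) \<mapsto> (\<sigma> y, \<sigma> x)\<close>; an invariant
  \<open>f\<close> has the same integral against both.\<close>

lemma sum_edge_measure_symmetrization:
  assumes f: "\<And>x y. f (\<sigma> y) (\<sigma> x) = f x y"
  shows "(\<Sum>x\<in>UNIV. pmf \<pi> x * (\<Sum>y\<in>UNIV. symmetrization \<pi> Q P $ x $ y * f x y))
    = (\<Sum>x\<in>UNIV. pmf \<pi> x * (\<Sum>y\<in>UNIV. P $ x $ y * f x y))"
proof -
  let ?p = "\<lambda>x y. pmf \<pi> x * P $ x $ y * f x y"
  have "(\<Sum>x\<in>UNIV. \<Sum>y\<in>UNIV. ?p (\<sigma> y) (\<sigma> x)) = (\<Sum>x\<in>UNIV. \<Sum>y\<in>UNIV. ?p y x)"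
    using sum.reindex_bij_betw[OF bij_\<sigma>, of "\<lambda>x. \<Sum>y\<in>UNIV. ?p (\<sigma> y) x"]
      sum.reindex_bij_betw[OF bij_\<sigma>, of "\<lambda>y. ?p y _"] by simp
  also have "\<dots> = (\<Sum>x\<in>UNIV. \<Sum>y\<in>UNIV. ?p x y)" by (rule sum.swap)
  finally have swap: "(\<Sum>x\<in>UNIV. \<Sum>y\<in>UNIV. ?p (\<sigma> y) (\<sigma> x)) = (\<Sum>x\<in>UNIV. \<Sum>y\<in>UNIV. ?p x y)" .
  have avg: "pmf \<pi> x * (symmetrization \<pi> Q P $ x $ y * f x y) = (?p x y + ?p (\<sigma> y) (\<sigma> x)) / 2" for x y
    using pmf_pos[of x] by (simp add: symmetrization_nth f pmf_\<sigma> field_simps)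
  have "(\<Sum>x\<in>UNIV. pmf \<pi> x * (\<Sum>y\<in>UNIV. symmetrization \<pi> Q P $ x $ y * f x y))
    = ((\<Sum>x\<in>UNIV. \<Sum>y\<in>UNIV. ?p x y) + (\<Sum>x\<in>UNIV. \<Sum>y\<in>UNIV. ?p (\<sigma> y) (\<sigma> x))) / 2"
    by (simp only: sum_distrib_left sum.distrib sum_divide_distrib add_divide_distrib avg)
  then show ?thesis unfolding swap by (simp add: mult.assoc flip: sum_distrib_left)
qed

lemma abs_cont_symmetrization:
  assumes "P \<in> transition_matrices"
  shows "abs_cont P (symmetrization \<pi> Q P)"
  using assms by (auto simp: abs_cont_def symmetrization_nth transition_matrices_def add_nonneg_eq_0_iff)

lemma abs_cont_stationary_projection: "abs_cont M (stationary_projection \<pi>)"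
  using pmf_pos by (auto simp: abs_cont_def stationary_projection_def pmf_vec_def less_le)

lemma symmetrization_mem_transition_matrices:
  assumes "P \<in> stationary_matrices \<pi>"
  shows "symmetrization \<pi> Q P \<in> transition_matrices"
proof -
  have "P \<in> transition_matrices" using assms by (simp add: stationary_matrices_def)
  moreover have "Q ** adj \<pi> P ** Q \<in> transition_matrices"
    by (intro transition_matrices_mult Q_transition adj_mem_transition_matrices full assms)
  ultimately show ?thesis
    by (simp add: transition_matrices_def symmetrization_def sum.distrib flip: sum_divide_distrib)
qed

lemma D_KL_pythagoras:
  assumes P: "P \<in> transition_matrices"
  shows "D_KL \<pi> P (symmetrization \<pi> Q P) + D_KL \<pi> (symmetrization \<pi> Q P) (stationary_projection \<pi>)
    = D_KL \<pi> P (stationary_projection \<pi>)"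
proof -
  let ?S = "symmetrization \<pi> Q P"
  \<comment> \<open>The logarithm of the density of the symmetrized edge measure with respect to the
    product measure; the factor \<open>pmf \<pi> x\<close> has cancelled.\<close>
  define f where "f = (\<lambda>x y. ln (?S $ x $ y / pmf \<pi> y))"
  have "f (\<sigma> y) (\<sigma> x) = f x y" for x y
  proof -
    have "?S $ \<sigma> y $ \<sigma> x / pmf \<pi> (\<sigma> x) = ?S $ x $ y / pmf \<pi> y"
      using pmf_pos[of x] pmf_pos[of y] by (simp add: symmetrization_nth pmf_\<sigma> \<sigma>_\<sigma> field_simps)
    then show ?thesis by (simp add: f_def)
  qed
  note f = sum_edge_measure_symmetrization[of f, OF this, of P]
  \<comment> \<open>The chain rule for densities, entry by entry. After summation, invariance of
    \<open>f\<close> allows \<open>P\<close> to be replaced by the symmetrization in the second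
    term.\<close>
  have split: "P $ x $ y * ln (P $ x $ y / ?S $ x $ y) + P $ x $ y * f x y
      = P $ x $ y * ln (P $ x $ y / pmf \<pi> y)" for x y
  proof (cases "P $ x $ y = 0")
    case False
    then have "P $ x $ y > 0" "?S $ x $ y \<noteq> 0"
      using P abs_cont_symmetrization[OF P] by (auto simp: transition_matrices_def less_le abs_cont_def)
    moreover have "?S $ x $ y \<ge> 0"
      using P by (simp add: symmetrization_nth transition_matrices_def)
    ultimately show ?thesis
      using pmf_pos[of y] by (simp add: f_def ln_div algebra_simps)
  qed simp
  have "(\<Sum>x\<in>UNIV. pmf \<pi> x * (\<Sum>y\<in>UNIV. P $ x $ y * ln (P $ x $ y / ?S $ x $ y)))
      + (\<Sum>x\<in>UNIV. pmf \<pi> x * (\<Sum>y\<in>UNIV. P $ x $ y * f x y))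
    = (\<Sum>x\<in>UNIV. pmf \<pi> x * (\<Sum>y\<in>UNIV. P $ x $ y * ln (P $ x $ y / pmf \<pi> y)))"
    by (simp only: sum_distrib_left sum.distrib distrib_left split[symmetric])
  with f show ?thesis
    unfolding D_KL_abs_cont[OF abs_cont_symmetrization[OF P]]
      D_KL_abs_cont[OF abs_cont_stationary_projection]
    by (simp add: stationary_projection_def pmf_vec_def f_def)
qed

section \<open>Fixed points of the symmetrization and contraction coefficients\<close>

lemma Q_conj_conj: "Q ** (Q ** A ** Q) ** Q = A"
proof -
  have "Q ** (Q ** A ** Q) ** Q = (Q ** Q) ** A ** (Q ** Q)"
    by (simp only: matrix_mul_assoc)
  then show ?thesis by (simp add: QQ)
qed

text \<open>A midpoint equals one endpoint iff the endpoints agree; conjugating by \<open>Q\<close>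
  then moves both factors \<open>Q\<close> to the other side.\<close>

lemma symmetrization_eq_iff:
  assumes "P \<in> stationary_matrices \<pi>"
  shows "symmetrization \<pi> Q P = P \<longleftrightarrow> P \<in> Q_reversible_matrices \<pi> Q"
proof -
  have "symmetrization \<pi> Q P = P \<longleftrightarrow> Q ** adj \<pi> P ** Q = P"
    by (auto simp: symmetrization_def vec_eq_iff field_simps)
  also have "\<dots> \<longleftrightarrow> adj \<pi> P = Q ** P ** Q"
    using Q_conj_conj by metis
  finally show ?thesis using assms by (simp add: Q_reversible_matrices_def)
qed

text \<open>Reversibility turns the symmetrization into the mean of \<open>P\<close> and
  \<open>Q ** P ** Q\<close>. Each ratio for it is at most the larger of the ratios of
  \<open>P\<close> at the pairs \<open>(M, N)\<close> and \<open>(M ** Q, N ** Q)\<close>.\<close>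

lemma c_KL_symmetrization_le:
  assumes P: "P \<in> transition_matrices" and rev: "reversible \<pi> P"
  shows "c_KL \<pi> (symmetrization \<pi> Q P) \<le> c_KL \<pi> P"
proof -
  have bound: "D_KL \<pi> (M ** symmetrization \<pi> Q P) (N ** symmetrization \<pi> Q P) / D_KL \<pi> M N
      \<le> Sup (c_KL_ratios \<pi> P)"
    if M: "M \<in> stationary_matrices \<pi>" and N: "N \<in> stationary_matrices \<pi>"
      and MN: "M \<noteq> N" "D_KL \<pi> M N < \<infinity>" for M N
  proof -
    have tr: "M \<in> transition_matrices" "N \<in> transition_matrices"
      using M N by (auto simp: stationary_matrices_def)
    \<comment> \<open>Strict positivity makes division by the common denominator monotone.\<close>
    have pos: "0 < D_KL \<pi> M N"
      using D_KL_nonneg[OF tr D_KL_finiteD[OF full MN(2)], of \<pi>] D_KL_eq_0D[OF full tr] MN(1)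
      by (auto simp: less_le)
    have split: "A ** symmetrization \<pi> Q P = (1 / 2) *\<^sub>R (A ** P + A ** Q ** P ** Q)" for A
    proof -
      have "A ** symmetrization \<pi> Q P = (1 / 2) *\<^sub>R (A ** P + A ** (Q ** P ** Q))"
        by (simp only: symmetrization_def rev[unfolded reversible_def, symmetric]
          matrix_add_ldistrib scaleR_right_distrib matrix_scalar_ac scalar_matrix_assoc[symmetric])
      then show ?thesis by (simp add: matrix_mul_assoc)
    qed
    have nonneg: "0 \<le> (A ** P) $ x $ y" "0 \<le> (A ** Q ** P ** Q) $ x $ y"
      if "A \<in> transition_matrices" for A x y
      using transition_matrices_mult[OF that P]
        transition_matrices_mult[OF transition_matrices_mult[OF transition_matrices_mult[OF
          that Q_transition] P] Q_transition]
      by (auto simp: transition_matrices_def)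
    have "D_KL \<pi> (M ** symmetrization \<pi> Q P) (N ** symmetrization \<pi> Q P)
        \<le> max (D_KL \<pi> (M ** P) (N ** P)) (D_KL \<pi> (M ** Q ** P ** Q) (N ** Q ** P ** Q))"
      unfolding split by (intro D_KL_midpoint_le_max full nonneg tr)
    then have le: "D_KL \<pi> (M ** symmetrization \<pi> Q P) (N ** symmetrization \<pi> Q P)
        \<le> max (D_KL \<pi> (M ** P) (N ** P)) (D_KL \<pi> (M ** Q ** P) (N ** Q ** P))"
      by (simp add: D_KL_mult_Q)
    \<comment> \<open>The translated pair is admissible in the supremum and has the same denominator
      as \<open>(M, N)\<close>.\<close>
    have "M ** Q \<noteq> N ** Q"
      using MN(1) QQ by (metis matrix_mul_assoc matrix_mul_rid)
    moreover have "D_KL \<pi> (M ** Q) (N ** Q) < \<infinity>"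
      using MN(2) by (simp add: D_KL_mult_Q)
    ultimately have "D_KL \<pi> (M ** Q ** P) (N ** Q ** P) / D_KL \<pi> (M ** Q) (N ** Q) \<in> c_KL_ratios \<pi> P"
      using stationary_matrices_mult[OF M Q_stationary] stationary_matrices_mult[OF N Q_stationary]
      unfolding c_KL_ratios_def by blast
    moreover have "D_KL \<pi> (M ** P) (N ** P) / D_KL \<pi> M N \<in> c_KL_ratios \<pi> P"
      using M N MN unfolding c_KL_ratios_def by blast
    ultimately have "max (D_KL \<pi> (M ** P) (N ** P)) (D_KL \<pi> (M ** Q ** P) (N ** Q ** P)) / D_KL \<pi> M N
        \<le> Sup (c_KL_ratios \<pi> P)"
      by (auto simp: max_def D_KL_mult_Q intro: Sup_upper)
    then show ?thesis
      using ereal_divide_right_mono[OF le pos] by (rule order_trans[rotated])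
  qed
  \<comment> \<open>Admissibility of \<open>(M, N)\<close> does not involve the matrix whose
    coefficient is taken, so the default value \<open>0\<close> occurs on both sides or on
    neither.\<close>
  have "c_KL_ratios \<pi> (symmetrization \<pi> Q P) = {} \<longleftrightarrow> c_KL_ratios \<pi> P = {}"
    by (auto simp: c_KL_ratios_def)
  moreover have "Sup (c_KL_ratios \<pi> (symmetrization \<pi> Q P)) \<le> Sup (c_KL_ratios \<pi> P)"
    using bound by (intro Sup_least) (auto simp: c_KL_ratios_def[of _ "symmetrization \<pi> Q P"])
  ultimately show ?thesis by (simp add: c_KL_def)
qed

end

theorem proposition3p3:
  fixes \<pi> :: "'n::finite pmf" and P Q :: "real ^ 'n ^ 'n"
  assumes "set_pmf \<pi> = UNIV"
    and "P \<in> stationary_matrices \<pi>"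
    and "Q \<in> involutions \<pi> \<inter> transition_matrices"
  shows "D_KL \<pi> (symmetrization \<pi> Q P) (stationary_projection \<pi>)
           \<le> D_KL \<pi> P (symmetrization \<pi> Q P)
             + D_KL \<pi> (symmetrization \<pi> Q P) (stationary_projection \<pi>) \<and>
         D_KL \<pi> P (symmetrization \<pi> Q P)
             + D_KL \<pi> (symmetrization \<pi> Q P) (stationary_projection \<pi>)
           = D_KL \<pi> P (stationary_projection \<pi>) \<and>
         (D_KL \<pi> (symmetrization \<pi> Q P) (stationary_projection \<pi>)
             = D_KL \<pi> P (symmetrization \<pi> Q P)
               + D_KL \<pi> (symmetrization \<pi> Q P) (stationary_projection \<pi>)
           \<longleftrightarrow> P \<in> Q_reversible_matrices \<pi> Q) \<and>
         (P \<in> Q_reversible_matrices \<pi> Q \<longrightarrow> symmetrization \<pi> Q P = P) \<and>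
         (reversible \<pi> P \<longrightarrow> c_KL \<pi> (symmetrization \<pi> Q P) \<le> c_KL \<pi> P)"
proof -
  obtain \<sigma> where "\<And>x. \<sigma> (\<sigma> x) = x" "\<And>x y. Q $ x $ y = (if y = \<sigma> x then 1 else 0)"
    using stochastic_involution_permutation[of Q] assms(3) by (auto simp: involutions_def)
  then interpret stationary_involution \<pi> Q \<sigma>
    using assms by unfold_locales auto
  let ?S = "symmetrization \<pi> Q P"
  have P: "P \<in> transition_matrices" using assms(2) by (simp add: stationary_matrices_def)
  note S = symmetrization_mem_transition_matrices[OF assms(2)]
  note ac = abs_cont_symmetrization[OF P] abs_cont_stationary_projection
  have nonneg: "0 \<le> D_KL \<pi> P ?S" by (rule D_KL_nonneg[OF P S ac(1)])
  \<comment> \<open>Cancellation of the common term is legitimate because absolute continuity makes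
    both divergences finite.\<close>
  have "D_KL \<pi> ?S (stationary_projection \<pi>)
      = D_KL \<pi> P ?S + D_KL \<pi> ?S (stationary_projection \<pi>) \<longleftrightarrow> D_KL \<pi> P ?S = 0"
    by (simp add: D_KL_abs_cont[OF ac(1)] D_KL_abs_cont[OF ac(2)] zero_ereal_def)
  also have "\<dots> \<longleftrightarrow> ?S = P"
  proof
    assume "?S = P"
    moreover have "kl_term a a = 0" for a by (simp add: kl_term_def)
    then have "D_KL \<pi> P P = 0" by (simp add: D_KL_def)
    ultimately show "D_KL \<pi> P ?S = 0" by simp
  qed (use D_KL_eq_0D[OF full P S] in simp)
  also note symmetrization_eq_iff[OF assms(2)]
  finally show ?thesis
    using nonneg D_KL_pythagoras[OF P] symmetrization_eq_iff[OF assms(2)] c_KL_symmetrization_le[OF P]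
      add_right_mono[OF nonneg, of "D_KL \<pi> ?S (stationary_projection \<pi>)"]
    by simp
qed

end
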